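(* (1) The semantics $\mathsf{SM}$ (subwalk-minimal) and $\mathsf{BT}$ (binding-trail) possess the subwalk guarantee. (2) None of the semantics $\mathsf{ShVC}$ (shortest-vertex-cover), $\mathsf{ShMS}$ (shortest-minimal-set), $\mathsf{MM}$ (minimal-multiset) and $\mathsf{Sh}$ (shortest-walk) possesses the subwalk guarantee. (3) No filter-based semantics possesses the subwalk guarantee.
   Context: Fix pairwise disjoint countably infinite sets $\mathbb V$ (vertex identifiers), $\mathbb E$ (edge identifiers), $\mathbb L$ (labels). Regular expressions are given by $R ::= \varepsilon \mid a \mid R^* \mid R\cdot R\mid R+R$ with $a\in\mathbb L$; $L(R)$ is the denoted language. A walk is a finite nonempty alternating sequence $w=(v_0,e_1,v_1,\dots,e_k,v_k)$ with $v_i\in\mathbb V$, $e_i\in\mathbb E$; its length is $\mathsf{Len}(w)=k$, its $i$-th edge is $w[i]=e_i$ and its endpoints are the pair $(v_0,v_k)$. $\mathsf{Walks}$ is the set of all walks (independently of any database). Walks $w$ and $w'$ concatenate if the last vertex of $w$ is the first vertex of $w'$; then $w\cdot w'$ is obtained by joining them with the shared vertex written once. A database $D=(L_D,V_D,E_D,\mathsf{Src}_D,\mathsf{Tgt}_D,\mathsf{Lbl}_D)$ consists of finite sets $L_D\subset\mathbb L$, $V_D\subset\mathbb V$, $E_D\subset\mathbb E$ and functions $\mathsf{Src}_D,\mathsf{Tgt}_D:E_D\to V_D$, $\mathsf{Lbl}_D:E_D\to L_D$. $\mathsf{Walks}(D)$ is the set of walks $(v_0,e_1,\dots,e_k,v_k)$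 with all $v_i\in V_D$, $e_i\in E_D$, $\mathsf{Src}_D(e_i)=v_{i-1}$ and $\mathsf{Tgt}_D(e_i)=v_i$; the label $\mathsf{Lbl}_D(w)$ of such a walk is the word $\mathsf{Lbl}_D(e_1)\cdots\mathsf{Lbl}_D(e_k)$. $\mathsf{Matches}(D,R)=\{w\in\mathsf{Walks}(D): \mathsf{Lbl}_D(w)\in L(R)\}$, and $\mathsf{Matches}(D,R,s,t)$ is the set of those $w\in \mathsf{Matches}(D,R)$ with endpoints $(s,t)$. A semantics $S$ is a function mapping every database $D$ and regular expression $R$ to a finite subset $S(D,R)$ of $\mathsf{Matches}(D,R)$. $S$ is filter-based if there is a function $f:\mathsf{Walks}\to\{\top,\bot\}$ with $S(D,R)=\{w\in\mathsf{Matches}(D,R): f(w)=\top\}$ for all $D,R$. The subwalk order $\sqsubseteq$ on $\mathsf{Walks}$ is the reflexive and transitive closure of the relation $F$ defined by: $w\mathrel F w'$ iff there are walks $w_1,w_2,w_3$ with $w=w_1\cdot w_3$ and $w'=w_1\cdot w_2\cdot w_3$. A subwalk of $w$ is a walk $w'$ with $w'\sqsubseteq w$. $S$ possesses the subwalk guarantee if for all $D,R$ and every $w\in\mathsf{Matches}(D,R)$ there is a subwalk of $w$ that belongs to $S(D,R)$. For a partial order $\preceq$ on walks, let $S_\preceq(D,R)=\bigcup_{s,t\in V_D}\min_\preceq\mathsf{Matches}(D,R,s,t)$ ($\min_\preceq X$ is the set of minimal elements of $X$). Let $\mathsf{ElemSet}(w)$ and $\mathsf{ElemBag}(w)$ be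 the set, respectively the multiset, of vertices and edges occurring in $w$. Then: - $\mathsf{SM}=S_\preceq$ with $\preceq$ equal to $\sqsubseteq$; - $\mathsf{Sh}=S_\preceq$ with $w\prec w'$ iff $\mathsf{Len}(w)<\mathsf{Len}(w')$; - $\mathsf{MM}=S_\preceq$ with $w\prec w'$ iff $\mathsf{ElemBag}(w)\subsetneq\mathsf{ElemBag}(w')$ (multiset inclusion); - $\mathsf{ShMS}=S_\preceq$ with $w\prec w'$ iff either $\mathsf{ElemSet}(w)\subsetneq\mathsf{ElemSet}(w')$, or $\mathsf{ElemSet}(w)=\mathsf{ElemSet}(w')$ and $\mathsf{Len}(w)<\mathsf{Len}(w')$; - $\mathsf{ShVC}(D,R)=\bigcup_{(s,t,v)\in V_D^3}\{$walks of minimal length among the walks of $\mathsf{Matches}(D,R,s,t)$ in which $v$ occurs$\}$; - $\mathsf{BT}$: let $R'$ be a linearisation of $R$, i.e. a copy of $R$ in which the $k$ atom (letter) occurrences are replaced by pairwise distinct symbols of a new alphabet $\Gamma$, and let $\beta:\Gamma\to\mathbb L$ map each new symbol to the letter it replaces (extended to words). Then $\mathsf{BT}(D,R)$ is the set of walks $w\in\mathsf{Matches}(D,R)$ for which there is a word $u=u_1\cdots u_{\mathsf{Len}(w)}\in L(R')$ with $\beta(u)=\mathsf{Lbl}_D(w)$ and such that there are no $i\neq j$ with $u_i=u_j$ and $w[i]=w[j]$. (All of these are semantics, i.e. always return finite sets.) *)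

theory Defs
  imports
    "HOL-Library.Countable"
    "HOL-Library.FuncSet"
    "HOL-Library.Infinite_Typeclass"
    "HOL-Library.Multiset"
begin

text \<open>Vertex identifiers, edge identifiers and labels are the elements of three types
  \<open>'v\<close>, \<open>'e\<close>, \<open>'l\<close>; disjointness is then automatic. The sorts
  \<^class>\<open>countable\<close> and \<^class>\<open>infinite\<close> are imposed in the theorem.\<close>


section \<open>Regular expressions\<close>

datatype 'l rexp =
    Eps
  | Atom 'l
  | Star "'l rexp"
  | Conc "'l rexp" "'l rexp"
  | Alt "'l rexp" "'l rexp"

primrec lang :: "'l rexp \<Rightarrow> 'l list set" where
  "lang Eps = {[]}"
| "lang (Atom a) = {[a]}"
| "lang (Star r) = {concat us | us. set us \<subseteq> lang r}"
| "lang (Conc r s) = {u @ v | u v. u \<in> lang r \<and> v \<in> lang s}"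
| "lang (Alt r s) = lang r \<union> lang s"

primrec atoms :: "'l rexp \<Rightarrow> 'l list" where
  "atoms Eps = []"
| "atoms (Atom a) = [a]"
| "atoms (Star r) = atoms r"
| "atoms (Conc r s) = atoms r @ atoms s"
| "atoms (Alt r s) = atoms r @ atoms s"

text \<open>Linearisation: the alphabet \<open>\<Gamma>\<close> consists of pairs \<open>(i, a)\<close>, where \<open>i\<close> is the
  position of the atom occurrence (from left to right) and \<open>a\<close> is the letter it carries,
  so that the projection \<open>\<beta>\<close> to the original letters is \<^const>\<open>snd\<close>. The first argument
  of \<open>linearise_from\<close> is the position given to the leftmost atom.\<close>

primrec linearise_from :: "nat \<Rightarrow> 'l rexp \<Rightarrow> (nat \<times> 'l) rexp" where
  "linearise_from n Eps = Eps"
| "linearise_from n (Atom a) = Atom (n, a)"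
| "linearise_from n (Star r) = Star (linearise_from n r)"
| "linearise_from n (Conc r s) =
     Conc (linearise_from n r) (linearise_from (n + length (atoms r)) s)"
| "linearise_from n (Alt r s) =
     Alt (linearise_from n r) (linearise_from (n + length (atoms r)) s)"

definition linearise :: "'l rexp \<Rightarrow> (nat \<times> 'l) rexp" where
  "linearise = linearise_from 0"

lemma map_snd_linearise: "map_rexp snd (linearise r) = r"
proof -
  have "map_rexp snd (linearise_from n r) = r" for n
    by (induction r arbitrary: n) auto
  then show ?thesis by (simp add: linearise_def)
qed

lemma distinct_atoms_linearise: "distinct (atoms (linearise r))"
proof -
  have *: "[n..<n + length xs] @ [n + length xs..<n + length xs + length ys] =
      [n..<n + (length xs + length ys)]" for n and xs ys :: "'l list"
    by (metis add.assoc le_add1 upt_add_eq_append)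
  have "map fst (atoms (linearise_from n r)) = [n..<n + length (atoms r)]" for n
    by (induction r arbitrary: n) (simp_all only: atoms.simps linearise_from.simps
        map_append length_append *, simp_all)
  then have "distinct (map fst (atoms (linearise r)))"
    by (simp add: linearise_def)
  then show ?thesis by (simp add: distinct_map)
qed


section \<open>Walks\<close>

text \<open>\<open>Walk v\<^sub>0 [(e\<^sub>1, v\<^sub>1), \<dots>, (e\<^sub>k, v\<^sub>k)]\<close> is the walk
  \<open>(v\<^sub>0, e\<^sub>1, v\<^sub>1, \<dots>, e\<^sub>k, v\<^sub>k)\<close>, so every element of the type is a walk.\<close>

datatype ('v, 'e) walk = Walk (first_vertex: 'v) (steps: "('e \<times> 'v) list")

definition wlen :: "('v, 'e) walk \<Rightarrow> nat" where
  "wlen w = length (steps w)"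

definition wverts :: "('v, 'e) walk \<Rightarrow> 'v list" where
  "wverts w = first_vertex w # map snd (steps w)"

definition wedges :: "('v, 'e) walk \<Rightarrow> 'e list" where
  "wedges w = map fst (steps w)"

definition last_vertex :: "('v, 'e) walk \<Rightarrow> 'v" where
  "last_vertex w = last (wverts w)"

definition endpoints :: "('v, 'e) walk \<Rightarrow> 'v \<times> 'v" where
  "endpoints w = (first_vertex w, last_vertex w)"

definition concatenate :: "('v, 'e) walk \<Rightarrow> ('v, 'e) walk \<Rightarrow> bool" where
  "concatenate w w' \<longleftrightarrow> last_vertex w = first_vertex w'"

text \<open>Meaningful only if the two walks concatenate.\<close>

definition wconc :: "('v, 'e) walk \<Rightarrow> ('v, 'e) walk \<Rightarrow> ('v, 'e) walk"  (infixl "\<cdot>" 70) where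
  "w \<cdot> w' = Walk (first_vertex w) (steps w @ steps w')"

definition factor_removal :: "('v, 'e) walk \<Rightarrow> ('v, 'e) walk \<Rightarrow> bool" where
  "factor_removal w w' \<longleftrightarrow>
     (\<exists>w1 w2 w3. concatenate w1 w3 \<and> w = w1 \<cdot> w3 \<and>
        concatenate w1 w2 \<and> concatenate (w1 \<cdot> w2) w3 \<and> w' = w1 \<cdot> w2 \<cdot> w3)"

definition subwalk :: "('v, 'e) walk \<Rightarrow> ('v, 'e) walk \<Rightarrow> bool"  (infix "\<sqsubseteq>" 50) where
  "(\<sqsubseteq>) = factor_removal\<^sup>*\<^sup>*"

definition ElemSet :: "('v, 'e) walk \<Rightarrow> ('v + 'e) set" where
  "ElemSet w = set (wverts w) <+> set (wedges w)"

definition ElemBag :: "('v, 'e) walk \<Rightarrow> ('v + 'e) multiset" where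
  "ElemBag w = image_mset Inl (mset (wverts w)) + image_mset Inr (mset (wedges w))"


section \<open>Databases and matches\<close>

record ('v, 'e, 'l) database =
  db_labels :: "'l set"
  db_verts :: "'v set"
  db_edges :: "'e set"
  Src :: "'e \<Rightarrow> 'v"
  Tgt :: "'e \<Rightarrow> 'v"
  Lbl :: "'e \<Rightarrow> 'l"

text \<open>The extensional function spaces make \<^const>\<open>Src\<close>, \<^const>\<open>Tgt\<close> and \<^const>\<open>Lbl\<close>
  carry no information outside the edge set.\<close>

definition is_database :: "('v, 'e, 'l) database \<Rightarrow> bool" where
  "is_database D \<longleftrightarrow>
     finite (db_labels D) \<and> finite (db_verts D) \<and> finite (db_edges D) \<and>
     Src D \<in> db_edges D \<rightarrow>\<^sub>E db_verts D \<and>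
     Tgt D \<in> db_edges D \<rightarrow>\<^sub>E db_verts D \<and>
     Lbl D \<in> db_edges D \<rightarrow>\<^sub>E db_labels D"

definition Walks :: "('v, 'e, 'l) database \<Rightarrow> ('v, 'e) walk set" where
  "Walks D = {w. set (wverts w) \<subseteq> db_verts D \<and> set (wedges w) \<subseteq> db_edges D \<and>
     (\<forall>i < wlen w. Src D (wedges w ! i) = wverts w ! i \<and>
                   Tgt D (wedges w ! i) = wverts w ! Suc i)}"

definition wlabel :: "('v, 'e, 'l) database \<Rightarrow> ('v, 'e) walk \<Rightarrow> 'l list" where
  "wlabel D w = map (Lbl D) (wedges w)"

definition Matches :: "('v, 'e, 'l) database \<Rightarrow> 'l rexp \<Rightarrow> ('v, 'e) walk set" where
  "Matches D R = {w \<in> Walks D. wlabel D w \<in> lang R}"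

definition Matches_between ::
    "('v, 'e, 'l) database \<Rightarrow> 'l rexp \<Rightarrow> 'v \<Rightarrow> 'v \<Rightarrow> ('v, 'e) walk set" where
  "Matches_between D R s t = {w \<in> Matches D R. endpoints w = (s, t)}"


section \<open>Semantics\<close>

type_synonym ('v, 'e, 'l) semantics =
  "('v, 'e, 'l) database \<Rightarrow> 'l rexp \<Rightarrow> ('v, 'e) walk set"

definition is_semantics :: "('v, 'e, 'l) semantics \<Rightarrow> bool" where
  "is_semantics S \<longleftrightarrow>
     (\<forall>D R. is_database D \<longrightarrow> finite (S D R) \<and> S D R \<subseteq> Matches D R)"

definition filter_based :: "('v, 'e, 'l) semantics \<Rightarrow> bool" where
  "filter_based S \<longleftrightarrow>
     (\<exists>f :: ('v, 'e) walk \<Rightarrow> bool.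
        \<forall>D R. is_database D \<longrightarrow> S D R = {w \<in> Matches D R. f w})"

definition subwalk_guarantee :: "('v, 'e, 'l) semantics \<Rightarrow> bool" where
  "subwalk_guarantee S \<longleftrightarrow>
     (\<forall>D R. is_database D \<longrightarrow> (\<forall>w \<in> Matches D R. \<exists>w'. w' \<sqsubseteq> w \<and> w' \<in> S D R))"

definition minimal_elems :: "('a \<Rightarrow> 'a \<Rightarrow> bool) \<Rightarrow> 'a set \<Rightarrow> 'a set" where
  "minimal_elems le X = {x \<in> X. \<forall>y \<in> X. le y x \<longrightarrow> y = x}"

definition minimal_semantics ::
    "(('v, 'e) walk \<Rightarrow> ('v, 'e) walk \<Rightarrow> bool) \<Rightarrow> ('v, 'e, 'l) semantics" where
  "minimal_semantics le D R =
     (\<Union>s \<in> db_verts D. \<Union>t \<in> db_verts D. minimal_elems le (Matches_between D R s t))"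

definition SM :: "('v, 'e, 'l) semantics" where
  "SM = minimal_semantics (\<sqsubseteq>)"

text \<open>The next three partial orders are the reflexive closures of strict relations.\<close>

definition Sh :: "('v, 'e, 'l) semantics" where
  "Sh = minimal_semantics (\<lambda>w w'. wlen w < wlen w')\<^sup>=\<^sup>="

definition MM :: "('v, 'e, 'l) semantics" where
  "MM = minimal_semantics (\<lambda>w w'. ElemBag w \<subset># ElemBag w')\<^sup>=\<^sup>="

definition ShMS :: "('v, 'e, 'l) semantics" where
  "ShMS = minimal_semantics
     (\<lambda>w w'. ElemSet w \<subset> ElemSet w' \<or> ElemSet w = ElemSet w' \<and> wlen w < wlen w')\<^sup>=\<^sup>="

definition ShVC :: "('v, 'e, 'l) semantics" where
  "ShVC D R =
     (\<Union>(s, t, v) \<in> db_verts D \<times> db_verts D \<times> db_verts D.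
        {w \<in> Matches_between D R s t. v \<in> set (wverts w) \<and>
           (\<forall>w' \<in> Matches_between D R s t. v \<in> set (wverts w') \<longrightarrow> wlen w \<le> wlen w')})"

definition BT :: "('v, 'e, 'l) semantics" where
  "BT D R =
     {w \<in> Matches D R. \<exists>u \<in> lang (linearise R).
        map snd u = wlabel D w \<and>
        \<not> (\<exists>i < wlen w. \<exists>j < wlen w. i \<noteq> j \<and> u ! i = u ! j \<and> wedges w ! i = wedges w ! j)}"

end

theory Submission
  imports Defs "HOL-Library.Sublist"
begin

text \<open>For \<^const>\<open>SM\<close>, a shortest matching subwalk with the same endpoints is
  \<open>\<sqsubseteq>\<close>-minimal. For \<^const>\<open>BT\<close>, the language of a linearised expression is local:
  two of its words that share a letter may be recombined at that letter. So whenever an edge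
  is bound twice to the same atom, the part of the walk between the two bindings can be cut
  out, and this terminates in a binding trail.

  All counterexamples use a single vertex with loops \<open>x\<close>, \<open>y\<close> of distinct labels
  \<open>a\<close>, \<open>b\<close>. The expression \<open>ab + bba\<close> matches exactly the loop sequences \<open>xy\<close> and
  \<open>yyx\<close>; all four semantics return only \<open>xy\<close>, which is not a subsequence of \<open>yyx\<close>. A
  filter accepts only finitely many of the walks \<open>x\<^sup>n\<close>, as \<open>a\<^sup>*\<close> has a finite answer;
  so for some \<open>n\<close> the answer to \<open>a\<^sup>n\<close> is empty, although \<open>x\<^sup>n\<close> matches.\<close>

section \<open>Regular expressions\<close>

text \<open>For \<open>f = snd\<close> on a linearised expression this is \<beta>: every word of the
  original language lifts to the linearisation, and every lifted word projects back.\<close>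

lemma lang_map_rexp: "lang (map_rexp f r) = map f ` lang r"
proof (induction r)
  case (Star r)
  have "{concat us | us. set us \<subseteq> map f ` lang r} = map f ` {concat us | us. set us \<subseteq> lang r}"
    (is "?A = ?B")
  proof
    show "?A \<subseteq> ?B"
    proof
      fix w assume "w \<in> ?A"
      then obtain us where w: "w = concat us" and "us \<in> lists (map f ` lang r)"
        by auto
      then obtain vs where "vs \<in> lists (lang r)" "us = map (map f) vs"
        by (auto simp: lists_image)
      then show "w \<in> ?B"
        by (auto simp: w map_concat[symmetric])
    qed
    show "?B \<subseteq> ?A"
      by (fastforce simp: map_concat)
  qed
  with Star show ?case by simp
next
  case (Conc r s)
  then show ?case
    by (force simp: image_iff)
qed auto

section \<open>Splitting words at a letter, and locality\<close>

lemma lang_atoms: "u \<in> lang r \<Longrightarrow> set u \<subseteq> set (atoms r)"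
  by (induction r arbitrary: u) fastforce+

text \<open>For a concatenation of expressions with disjoint atoms: the marked \<open>a\<close> must
  fall into the factor that can contain it.\<close>

lemma append_eq_append_Cons_left:
  assumes "u @ v = p @ a # q" and "a \<notin> set v"
  obtains q' where "u = p @ a # q'" and "q = q' @ v"
  using assms by (auto simp: append_eq_append_conv2 append_eq_Cons_conv Cons_eq_append_conv)

lemma append_eq_append_Cons_right:
  assumes "u @ v = p @ a # q" and "a \<notin> set u"
  obtains p' where "v = p' @ a # q" and "p = u @ p'"
  using assms by (auto simp: append_eq_append_conv2 append_eq_Cons_conv Cons_eq_append_conv)

text \<open>For the star: the marked \<open>a\<close> lies inside one block, which is split there
  into \<open>x\<close> and \<open>y\<close>.\<close>

lemma concat_eq_append_Cons:
  assumes "concat us = p @ a # q"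
  obtains us1 x y us2 where "us = us1 @ (x @ a # y) # us2"
    and "p = concat us1 @ x" and "q = y @ concat us2"
  using assms
proof (induction us arbitrary: p thesis)
  case (Cons u us)
  from Cons.prems(2) consider p' where "p = u @ p'" "concat us = p' @ a # q"
    | q' where "u = p @ a # q'" "q = q' @ concat us"
    by (auto simp: append_eq_append_conv2 append_eq_Cons_conv Cons_eq_append_conv)
  then show ?case
  proof cases
    case 1
    from 1(2) obtain us1 x y us2 where "us = us1 @ (x @ a # y) # us2"
      "p' = concat us1 @ x" "q = y @ concat us2"
      using Cons.IH by blast
    with 1 show ?thesis
      by (intro Cons.prems(1)[of "u # us1" x y us2]) auto
  next
    case 2
    then show ?thesis
      by (intro Cons.prems(1)[of "[]" p q' us]) auto
  qed
qed simp

text \<open>As no atom is repeated, the letter \<open>a\<close> fixes the position reached in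
  \<open>r\<close>, so the continuations possible after it do not depend on the prefix read
  before.\<close>

lemma lang_local:
  assumes "distinct (atoms r)" and "p @ a # q \<in> lang r" and "p' @ a # q' \<in> lang r"
  shows "p @ a # q' \<in> lang r"
  using assms
proof (induction r arbitrary: p q p' q')
  case (Atom b)
  then show ?case by (auto simp: append_eq_Cons_conv)
next
  case (Star r)
  from Star.prems obtain us us' where us: "set us \<subseteq> lang r" "concat us = p @ a # q"
    and us': "set us' \<subseteq> lang r" "concat us' = p' @ a # q'"
    by auto
  obtain us1 x y us2 where 1: "us = us1 @ (x @ a # y) # us2" "p = concat us1 @ x"
    using us(2) by (rule concat_eq_append_Cons)
  obtain us1' x' y' us2' where 2: "us' = us1' @ (x' @ a # y') # us2'" "q' = y' @ concat us2'"
    using us'(2) by (rule concat_eq_append_Cons)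
  \<comment> \<open>Only the two blocks that contain the marked \<open>a\<close> are recombined by
    induction; whole blocks of \<open>us\<close> precede the result and whole blocks of
    \<open>us'\<close> follow it.\<close>
  have "x @ a # y' \<in> lang r"
    using Star.IH[of x y x' y'] Star.prems(1) us(1) us'(1) 1 2 by simp
  then have "set (us1 @ (x @ a # y') # us2') \<subseteq> lang r"
    using us(1) us'(1) 1 2 by simp
  moreover have "p @ a # q' = concat (us1 @ (x @ a # y') # us2')"
    using 1 2 by simp
  ultimately show ?case
    unfolding lang.simps by blast
next
  case (Conc r s)
  from Conc.prems obtain u v u' v' where
    uv: "u @ v = p @ a # q" "u \<in> lang r" "v \<in> lang s" and
    uv': "u' @ v' = p' @ a # q'" "u' \<in> lang r" "v' \<in> lang s"
    by auto
  note sub = lang_atoms[OF uv(2)] lang_atoms[OF uv(3)] lang_atoms[OF uv'(2)] lang_atoms[OF uv'(3)]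
  have disj: "set (atoms r) \<inter> set (atoms s) = {}" and dist: "distinct (atoms r)" "distinct (atoms s)"
    using Conc.prems(1) by auto
  have "a \<in> set (u @ v)"
    using uv(1) by simp
  then consider "a \<in> set (atoms r)" | "a \<in> set (atoms s)"
    using sub by auto
  then show ?case
  proof cases
    case 1
    then have "a \<notin> set v" "a \<notin> set v'"
      using sub disj by auto
    then obtain y y' where "u = p @ a # y" "u' = p' @ a # y'" "q' = y' @ v'"
      using uv(1) uv'(1) append_eq_append_Cons_left by metis
    then have "p @ a # y' \<in> lang r" "p @ a # q' = (p @ a # y') @ v'"
      using Conc.IH(1)[OF dist(1), of p y p' y'] uv(2) uv'(2) by simp_all
    then show ?thesis
      using uv'(3) unfolding lang.simps by blast
  next
    case 2
    then have "a \<notin> set u" "a \<notin> set u'"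
      using sub disj by auto
    then obtain x x' where "v = x @ a # q" "p = u @ x" "v' = x' @ a # q'"
      using uv(1) uv'(1) append_eq_append_Cons_right by metis
    then have "x @ a # q' \<in> lang s" "p @ a # q' = u @ (x @ a # q')"
      using Conc.IH(2)[OF dist(2), of x q x' q'] uv(3) uv'(3) by simp_all
    then show ?thesis
      using uv(2) unfolding lang.simps by blast
  qed
next
  case (Alt r s)
  have disj: "set (atoms r) \<inter> set (atoms s) = {}" and dist: "distinct (atoms r)" "distinct (atoms s)"
    using Alt.prems(1) by auto
  have letter: "a \<in> set (atoms t)" if "x @ a # y \<in> lang t" for t x y
    using lang_atoms[OF that] by simp
  from Alt.prems(2) consider "p @ a # q \<in> lang r" | "p @ a # q \<in> lang s"
    by auto
  then show ?case
  proof cases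
    case 1
    \<comment> \<open>The letter \<open>a\<close> is an atom of \<open>r\<close> and not of
      \<open>s\<close>, which forces the second word into the same alternative.\<close>
    then have "p' @ a # q' \<in> lang r"
      using Alt.prems(3) letter[of p q r] letter[of p' q' s] disj by auto
    with 1 show ?thesis
      using Alt.IH(1)[OF dist(1), of p q p' q'] by simp
  next
    case 2
    then have "p' @ a # q' \<in> lang s"
      using Alt.prems(3) letter[of p q s] letter[of p' q' r] disj by auto
    with 2 show ?thesis
      using Alt.IH(2)[OF dist(2), of p q p' q'] by simp
  qed
qed simp

primrec word_rexp :: "'l list \<Rightarrow> 'l rexp" where
  "word_rexp [] = Eps"
| "word_rexp (a # u) = Conc (Atom a) (word_rexp u)"

lemma lang_word_rexp [simp]: "lang (word_rexp u) = {u}"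
  by (induction u) auto

section \<open>Walks and subwalks\<close>

lemma factor_removal_subseq:
  "factor_removal w w' \<Longrightarrow> first_vertex w = first_vertex w' \<and> subseq (steps w) (steps w')"
  by (auto simp: factor_removal_def wconc_def subseq_append' intro: list_emb_append2)

text \<open>Necessary but not sufficient, since a removed factor must also be closed. It yields the
  length bounds and refutes subwalks in the counterexamples.\<close>

lemma subwalk_subseq:
  assumes "w \<sqsubseteq> w'"
  shows "first_vertex w = first_vertex w' \<and> subseq (steps w) (steps w')"
  using assms unfolding subwalk_def
  by (induction rule: rtranclp_induct) (auto dest!: factor_removal_subseq intro: subseq_order.trans)

lemma subwalk_wlen: "w \<sqsubseteq> w' \<Longrightarrow> wlen w \<le> wlen w'"
  by (auto dest!: subwalk_subseq list_emb_length simp: wlen_def)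

lemma subwalk_same_wlen: "w \<sqsubseteq> w' \<Longrightarrow> wlen w = wlen w' \<Longrightarrow> w = w'"
  by (metis subwalk_subseq subseq_same_length wlen_def walk.expand)

lemma subwalk_wedges: "w \<sqsubseteq> w' \<Longrightarrow> subseq (wedges w) (wedges w')"
  unfolding wedges_def using subwalk_subseq subseq_map by blast

lemma subwalk_refl: "w \<sqsubseteq> w"
  by (simp add: subwalk_def)

lemma subwalk_trans: "u \<sqsubseteq> v \<Longrightarrow> v \<sqsubseteq> w \<Longrightarrow> u \<sqsubseteq> w"
  by (simp add: subwalk_def)

text \<open>Both copies of the step end in \<open>x\<close>, so \<open>q\<close> followed by the
  second copy is a closed walk at \<open>x\<close> and can be removed.\<close>

lemma factor_removal_between_equal_steps:
  "factor_removal (Walk v (p @ (e, x) # r)) (Walk v (p @ (e, x) # q @ (e, x) # r))"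
  unfolding factor_removal_def
  by (rule exI[of _ "Walk v (p @ [(e, x)])"], rule exI[of _ "Walk x (q @ [(e, x)])"],
      rule exI[of _ "Walk x r"])
    (simp add: concatenate_def wconc_def last_vertex_def wverts_def)

section \<open>Walks of a database under concatenation and factor removal\<close>

lemma Walk_Nil_in_Walks: "Walk v [] \<in> Walks D \<longleftrightarrow> v \<in> db_verts D"
  by (simp add: Walks_def wverts_def wedges_def wlen_def)

lemma Walk_Cons_in_Walks:
  "Walk v ((e, x) # xs) \<in> Walks D \<longleftrightarrow>
     v \<in> db_verts D \<and> e \<in> db_edges D \<and> Src D e = v \<and> Tgt D e = x \<and> Walk x xs \<in> Walks D"
  by (auto simp: Walks_def wverts_def wedges_def wlen_def All_less_Suc2)

lemma Walk_append_in_Walks: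
  "Walk v (xs @ ys) \<in> Walks D \<longleftrightarrow>
     Walk v xs \<in> Walks D \<and> Walk (last_vertex (Walk v xs)) ys \<in> Walks D"
proof (induction xs arbitrary: v)
  case Nil
  have "Walk v ys \<in> Walks D \<Longrightarrow> v \<in> db_verts D"
    by (simp add: Walks_def wverts_def)
  then show ?case
    by (auto simp: Walk_Nil_in_Walks last_vertex_def wverts_def)
next
  case (Cons s xs)
  obtain e x where "s = (e, x)"
    by fastforce
  with Cons show ?case
    by (auto simp: Walk_Cons_in_Walks last_vertex_def wverts_def)
qed

lemma wconc_in_Walks:
  assumes "concatenate w w'"
  shows "w \<cdot> w' \<in> Walks D \<longleftrightarrow> w \<in> Walks D \<and> w' \<in> Walks D"
  using assms Walk_append_in_Walks[of "first_vertex w" "steps w" "steps w'" D]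
  by (simp add: wconc_def concatenate_def)

lemma factor_removal_in_Walks: "factor_removal w w' \<Longrightarrow> w' \<in> Walks D \<Longrightarrow> w \<in> Walks D"
  by (auto simp: factor_removal_def wconc_in_Walks)

text \<open>An edge determines the vertex it leads to, so the bindings in \<open>BT\<close> can be
  compared as pairs of a letter and a step.\<close>

lemma Walks_steps:
  assumes "w \<in> Walks D" and "(e, x) \<in> set (steps w)"
  shows "x = Tgt D e"
proof -
  obtain i where "i < length (steps w)" "steps w ! i = (e, x)"
    using assms(2) by (auto simp: in_set_conv_nth)
  with assms(1) show ?thesis
    by (auto simp: Walks_def wlen_def wedges_def wverts_def)
qed

section \<open>Semantics with the subwalk guarantee\<close>

lemma subwalk_guarantee_SM: "subwalk_guarantee SM"
  unfolding subwalk_guarantee_def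
proof (intro allI impI ballI)
  fix D :: "('v, 'e, 'l) database" and R w
  assume "w \<in> Matches D R"
  define s t where "s = first_vertex w" and "t = last_vertex w"
  have w: "w \<in> Matches_between D R s t"
    using \<open>w \<in> Matches D R\<close> by (simp add: Matches_between_def endpoints_def s_def t_def)
  have "set (wverts w) \<subseteq> db_verts D"
    using \<open>w \<in> Matches D R\<close> by (simp add: Matches_def Walks_def)
  moreover have "s \<in> set (wverts w)" "t \<in> set (wverts w)"
    unfolding s_def t_def last_vertex_def by (simp add: wverts_def, rule last_in_set, simp add: wverts_def)
  ultimately have st: "s \<in> db_verts D" "t \<in> db_verts D"
    by auto
  obtain w' where w': "w' \<in> Matches_between D R s t" "w' \<sqsubseteq> w"
    and least: "\<And>y. y \<in> Matches_between D R s t \<Longrightarrow> y \<sqsubseteq> w \<Longrightarrow> wlen w' \<le> wlen y"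
    using ex_has_least_nat[of "\<lambda>y. y \<in> Matches_between D R s t \<and> y \<sqsubseteq> w" w wlen] w subwalk_refl
    by blast
  \<comment> \<open>Such a \<open>y\<close> is also a subwalk of \<open>w\<close>, so by leastness
    it is as long as \<open>w'\<close>, and a subwalk of full length is the walk itself.\<close>
  have "y = w'" if "y \<in> Matches_between D R s t" "y \<sqsubseteq> w'" for y
    using that least[of y] subwalk_trans[OF that(2) w'(2)] subwalk_wlen[OF that(2)]
    by (auto intro: subwalk_same_wlen)
  then have "w' \<in> SM D R"
    using w'(1) st by (auto simp: SM_def minimal_semantics_def minimal_elems_def)
  with w'(2) show "\<exists>w'. w' \<sqsubseteq> w \<and> w' \<in> SM D R"
    by blast
qed

text \<open>The word \<open>u\<close> is generalised because each cut shortens it together with the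
  walk; the induction is on the length of the walk.\<close>

lemma ex_subwalk_BT:
  assumes "w \<in> Walks D" and "u \<in> lang (linearise R)" and "map snd u = wlabel D w"
  shows "\<exists>w'. w' \<sqsubseteq> w \<and> w' \<in> BT D R"
  using assms
proof (induction w arbitrary: u rule: measure_induct_rule[of wlen])
  case (less w)
  have len: "length u = length (steps w)"
    using arg_cong[OF less.prems(3), of length] by (simp add: wlabel_def wedges_def)
  show ?case
  proof (cases "distinct (zip u (steps w))")
    case True
    have "wlabel D w \<in> lang R"
      using less.prems(2) lang_map_rexp[of snd "linearise R"]
      by (simp add: map_snd_linearise less.prems(3)[symmetric])
    then have "w \<in> Matches D R"
      using less.prems(1) by (simp add: Matches_def)
    moreover have "i = j"
      if "i < wlen w" "j < wlen w" "u ! i = u ! j" "wedges w ! i = wedges w ! j" for i j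
    proof -
      have "steps w ! i = steps w ! j"
        using that Walks_steps[OF less.prems(1)]
        by (metis nth_map nth_mem prod.collapse wedges_def wlen_def)
      then show ?thesis
        using True that nth_eq_iff_index_eq[of "zip u (steps w)" i j] len by (simp add: wlen_def)
    qed
    ultimately have "w \<in> BT D R"
      using less.prems(2,3) by (auto simp: BT_def)
    then show ?thesis
      using subwalk_refl by blast
  next
    case False
    then obtain c e x p q r where "zip u (steps w) =
        p @ [(c, (e, x))] @ q @ [(c, (e, x))] @ r"
      using not_distinct_decomp by (metis prod.collapse)
    then have "map fst (zip u (steps w)) = map fst (p @ (c, (e, x)) # q @ (c, (e, x)) # r)"
      and "map snd (zip u (steps w)) = map snd (p @ (c, (e, x)) # q @ (c, (e, x)) # r)"
      by simp_all
    then have u: "u = map fst p @ c # map fst q @ c # map fst r"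
      and steps: "steps w = map snd p @ (e, x) # map snd q @ (e, x) # map snd r"
      using len by simp_all
    define w' where "w' = Walk (first_vertex w) (map snd p @ (e, x) # map snd r)"
    have removal: "factor_removal w' w"
      using factor_removal_between_equal_steps steps
      by (metis w'_def walk.collapse)
    \<comment> \<open>Locality is applied to \<open>u\<close> against itself: its prefix up to the
      first marked \<open>c\<close> is joined to its suffix after the second.\<close>
    have "map fst p @ c # map fst r \<in> lang (linearise R)"
      using lang_local[OF distinct_atoms_linearise, of "map fst p" c "map fst q @ c # map fst r" R
          "map fst p @ c # map fst q" "map fst r"] less.prems(2) u
      by simp
    moreover have "map snd (map fst p @ c # map fst r) = wlabel D w'"
    proof -
      have "length (map snd (map fst p)) = length (map (Lbl D \<circ> fst) (map snd p))"
        and "length (map snd (map fst q)) = length (map (Lbl D \<circ> fst) (map snd q))"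
        by simp_all
      then show ?thesis
        using less.prems(3) unfolding u wlabel_def wedges_def w'_def steps
        by (simp add: comp_assoc)
    qed
    moreover have "wlen w' < wlen w"
      by (simp add: w'_def wlen_def steps)
    moreover have "w' \<in> Walks D"
      using removal less.prems(1) by (rule factor_removal_in_Walks)
    ultimately obtain w'' where "w'' \<sqsubseteq> w'" "w'' \<in> BT D R"
      using less.IH by blast
    moreover have "w' \<sqsubseteq> w"
      using removal by (simp add: subwalk_def)
    ultimately show ?thesis
      using subwalk_trans by blast
  qed
qed

lemma subwalk_guarantee_BT: "subwalk_guarantee BT"
  unfolding subwalk_guarantee_def
proof (intro allI impI ballI)
  fix D :: "('v, 'e, 'l) database" and R w
  assume w: "w \<in> Matches D R"
  then have "wlabel D w \<in> map snd ` lang (linearise R)"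
    using lang_map_rexp[of snd "linearise R"] by (simp add: map_snd_linearise Matches_def)
  then show "\<exists>w'. w' \<sqsubseteq> w \<and> w' \<in> BT D R"
    using w ex_subwalk_BT by (force simp: Matches_def)
qed

section \<open>Databases with a single vertex\<close>

text \<open>\<open>restrict\<close> makes the three functions extensional, as
  \<open>is_database\<close> demands.\<close>

definition bouquet :: "'v \<Rightarrow> 'e set \<Rightarrow> ('e \<Rightarrow> 'l) \<Rightarrow> ('v, 'e, 'l) database" where
  "bouquet v E l = \<lparr>db_labels = l ` E, db_verts = {v}, db_edges = E,
     Src = restrict (\<lambda>_. v) E, Tgt = restrict (\<lambda>_. v) E, Lbl = restrict l E\<rparr>"

definition loops :: "'v \<Rightarrow> 'e list \<Rightarrow> ('v, 'e) walk" where
  "loops v es = Walk v (map (\<lambda>e. (e, v)) es)"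

lemma is_database_bouquet: "finite E \<Longrightarrow> is_database (bouquet v E l)"
  by (auto simp: is_database_def bouquet_def)

lemma db_verts_bouquet [simp]: "db_verts (bouquet v E l) = {v}"
  by (simp add: bouquet_def)

lemma wedges_loops [simp]: "wedges (loops v es) = es"
  by (simp add: wedges_def loops_def comp_def)

lemma wlen_loops [simp]: "wlen (loops v es) = length es"
  by (simp add: wlen_def loops_def)

lemma wverts_loops [simp]: "wverts (loops v es) = replicate (Suc (length es)) v"
  by (simp add: wverts_def loops_def comp_def map_replicate_const)

lemma endpoints_loops [simp]: "endpoints (loops v es) = (v, v)"
  by (simp add: endpoints_def last_vertex_def) (simp add: loops_def)

lemma loops_inject [simp]: "loops v es = loops v fs \<longleftrightarrow> es = fs"
  using wedges_loops by metis

lemma Walks_bouquet: "Walks (bouquet v E l) = loops v ` lists E"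
proof -
  have *: "Walk x xs \<in> Walks (bouquet v E l) \<longleftrightarrow> x = v \<and> set xs \<subseteq> E \<times> {v}" for x xs
  proof (induction xs arbitrary: x)
    case (Cons s xs)
    obtain e y where "s = (e, y)"
      by fastforce
    with Cons[of y] show ?case
      by (auto simp: Walk_Cons_in_Walks bouquet_def)
  qed (simp add: Walk_Nil_in_Walks)
  show ?thesis
  proof (intro subset_antisym subsetI)
    fix w assume "w \<in> Walks (bouquet v E l)"
    then have w: "first_vertex w = v" "set (steps w) \<subseteq> E \<times> {v}"
      using *[of "first_vertex w" "steps w"] by simp_all
    then have "map (\<lambda>e. (e, v)) (wedges w) = steps w"
      by (auto simp: wedges_def intro!: map_idI)
    then have "w = loops v (wedges w)"
      using w(1) by (cases w) (simp add: loops_def)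
    moreover have "wedges w \<in> lists E"
      using w(2) by (fastforce simp: wedges_def)
    ultimately show "w \<in> loops v ` lists E"
      by (rule image_eqI)
  next
    fix w assume "w \<in> loops v ` lists E"
    then show "w \<in> Walks (bouquet v E l)"
      by (auto simp: loops_def *)
  qed
qed

text \<open>With one vertex, any edge sequence over \<open>E\<close> is a walk, so matching becomes
  a question about words only.\<close>

lemma Matches_bouquet:
  "Matches (bouquet v E l) R = loops v ` {es \<in> lists E. map l es \<in> lang R}"
proof -
  have "wlabel (bouquet v E l) (loops v es) = map l es" if "\<forall>e\<in>set es. e \<in> E" for es
    using that by (auto simp: wlabel_def bouquet_def)
  then show ?thesis
    by (auto simp: Matches_def Walks_bouquet intro!: imageI)
qed

lemma Matches_between_bouquet:
  "Matches_between (bouquet v E l) R v v = Matches (bouquet v E l) R"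
  by (auto simp: Matches_between_def Matches_bouquet)

section \<open>Semantics without the subwalk guarantee\<close>

lemma ex_bouquet_swap:
  obtains D :: "('v, 'e :: infinite, 'l :: infinite) database" and R v x y
  where "is_database D" and "db_verts D = {v}" and "x \<noteq> y"
    and "Matches D R = {loops v [x, y], loops v [y, y, x]}"
    and "Matches_between D R v v = Matches D R"
proof -
  obtain x y :: 'e where xy: "x \<noteq> y"
    by (metis ex_new_if_finite finite.emptyI finite.insertI infinite_UNIV insertI1)
  obtain a b :: 'l where ab: "a \<noteq> b"
    by (metis ex_new_if_finite finite.emptyI finite.insertI infinite_UNIV insertI1)
  define l where "l = (\<lambda>e. if e = x then a else b)"
  define D :: "('v, 'e, 'l) database" where "D = bouquet undefined {x, y} l"
  define R where "R = Alt (word_rexp (map l [x, y])) (word_rexp (map l [y, y, x]))"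
  \<comment> \<open>Distinct labels let the label word determine the edge sequence, so
    \<open>R\<close> matches exactly two walks.\<close>
  have inj: "inj_on l {x, y}"
    using xy ab by (auto simp: l_def)
  have "map l es \<in> lang R \<longleftrightarrow> es \<in> {[x, y], [y, y, x]}" if "es \<in> lists {x, y}" for es
  proof -
    have "map l es = map l fs \<longleftrightarrow> es = fs" if "fs \<in> lists {x, y}" for fs
      using that \<open>es \<in> lists {x, y}\<close>
      by (intro inj_on_map_eq_map inj_on_subset[OF inj]) auto
    from this[of "[x, y]"] this[of "[y, y, x]"] show ?thesis
      by (auto simp: R_def simp del: list.map)
  qed
  then have "{es \<in> lists {x, y}. map l es \<in> lang R} =
      {es \<in> lists {x, y}. es \<in> {[x, y], [y, y, x]}}"
    by blast
  also have "\<dots> = {[x, y], [y, y, x]}"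
    by auto
  finally have "Matches D R = {loops undefined [x, y], loops undefined [y, y, x]}"
    by (simp add: D_def Matches_bouquet)
  then show thesis
    using that[of D undefined x y R] xy
    by (simp add: D_def is_database_bouquet Matches_between_bouquet)
qed

text \<open>Isolates what depends on \<open>S\<close>: it suffices that the longer of the two
  matches is never returned.\<close>

lemma not_subwalk_guaranteeI:
  fixes S :: "('v, 'e :: infinite, 'l :: infinite) semantics"
  assumes "\<And>D R v x y. \<lbrakk>is_database D; db_verts D = {v}; x \<noteq> y;
      Matches_between D R v v = {loops v [x, y], loops v [y, y, x]}\<rbrakk>
      \<Longrightarrow> S D R \<subseteq> {loops v [x, y]}"
  shows "\<not> subwalk_guarantee S"
proof
  assume guarantee: "subwalk_guarantee S"
  obtain D :: "('v, 'e, 'l) database" and R v x y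
    where D: "is_database D" "db_verts D = {v}" and "x \<noteq> y"
      and matches: "Matches D R = {loops v [x, y], loops v [y, y, x]}"
      and between: "Matches_between D R v v = Matches D R"
    by (rule ex_bouquet_swap)
  have "S D R \<subseteq> {loops v [x, y]}"
    using assms[OF D \<open>x \<noteq> y\<close>] matches between by simp
  moreover obtain w' where w': "w' \<sqsubseteq> loops v [y, y, x]" "w' \<in> S D R"
    using guarantee D(1) matches unfolding subwalk_guarantee_def by blast
  ultimately have "w' = loops v [x, y]"
    by blast
  then have "subseq [x, y] [y, y, x]"
    using subwalk_wedges[OF w'(1)] by simp
  \<comment> \<open>The only \<open>x\<close> of \<open>[y, y, x]\<close> comes last, so no
    \<open>y\<close> follows it.\<close>
  then show False
    using \<open>x \<noteq> y\<close> by simp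
qed

lemma not_subwalk_guarantee_minimal_semantics:
  assumes "\<And>v x y. x \<noteq> y \<Longrightarrow> le (loops v [x, y]) (loops v [y, y, x])"
  shows "\<not> subwalk_guarantee
    (minimal_semantics le :: ('v, 'e :: infinite, 'l :: infinite) semantics)"
  by (rule not_subwalk_guaranteeI) (auto simp: minimal_semantics_def minimal_elems_def assms)

lemma not_subwalk_guarantee_Sh:
  "\<not> subwalk_guarantee (Sh :: ('v, 'e :: infinite, 'l :: infinite) semantics)"
  unfolding Sh_def by (rule not_subwalk_guarantee_minimal_semantics) simp

lemma not_subwalk_guarantee_MM:
  "\<not> subwalk_guarantee (MM :: ('v, 'e :: infinite, 'l :: infinite) semantics)"
  unfolding MM_def
proof (rule not_subwalk_guarantee_minimal_semantics)
  fix v :: 'v and x y :: 'e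
  \<comment> \<open>The longer walk uses \<open>y\<close> once more and therefore visits
    \<open>v\<close> once more.\<close>
  have "ElemBag (loops v [y, y, x]) = ElemBag (loops v [x, y]) + {#Inl v, Inr y#}"
    by (simp add: ElemBag_def)
  then show "(\<lambda>w w'. ElemBag w \<subset># ElemBag w')\<^sup>=\<^sup>= (loops v [x, y]) (loops v [y, y, x])"
    by (simp add: subset_mset.less_le)
qed

text \<open>Both walks have the elements \<open>v\<close>, \<open>x\<close>, \<open>y\<close>, so
  the length decides.\<close>

lemma not_subwalk_guarantee_ShMS:
  "\<not> subwalk_guarantee (ShMS :: ('v, 'e :: infinite, 'l :: infinite) semantics)"
  unfolding ShMS_def
  by (rule not_subwalk_guarantee_minimal_semantics) (auto simp: ElemSet_def)

text \<open>Both walks cover the single vertex, so only the shorter one survives.\<close>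

lemma not_subwalk_guarantee_ShVC:
  "\<not> subwalk_guarantee (ShVC :: ('v, 'e :: infinite, 'l :: infinite) semantics)"
  by (rule not_subwalk_guaranteeI) (auto simp: ShVC_def)

lemma not_subwalk_guarantee_filter_based:
  fixes S :: "('v, 'e, 'l) semantics"
  assumes "is_semantics S" and "filter_based S"
  shows "\<not> subwalk_guarantee S"
proof
  assume guarantee: "subwalk_guarantee S"
  obtain f where f: "\<And>D R. is_database D \<Longrightarrow> S D R = {w \<in> Matches D R. f w}"
    using assms(2) unfolding filter_based_def by blast
  fix v :: 'v and e :: 'e and a :: 'l
  define D where "D = bouquet v {e} (\<lambda>_. a)"
  have D: "is_database D"
    by (simp add: D_def is_database_bouquet)
  define power where "power n = loops v (replicate n e)" for n
  have "power n \<in> Matches D (Star (Atom a))" for n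
  proof -
    have "replicate n a = concat (replicate n [a])" "set (replicate n [a]) \<subseteq> {[a]}"
      by (induction n) auto
    then have "replicate n a \<in> lang (Star (Atom a))"
      unfolding lang.simps by blast
    then show ?thesis
      by (auto simp: D_def Matches_bouquet power_def simp del: lang.simps)
  qed
  then have "power ` {n. f (power n)} \<subseteq> S D (Star (Atom a))"
    using f[OF D] by auto
  then have "finite (power ` {n. f (power n)})"
    using assms(1) D finite_subset unfolding is_semantics_def by blast
  moreover have "inj power"
    by (auto simp: inj_def power_def)
  \<comment> \<open>The accepted powers all belong to the finite answer to
    \<open>Star (Atom a)\<close>, and distinct exponents give distinct walks.\<close>
  ultimately have "finite {n. f (power n)}"
    using finite_imageD inj_on_subset by blast
  then obtain n where n: "\<not> f (power n)"
    using ex_new_if_finite[OF infinite_UNIV_nat] by blast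
  \<comment> \<open>This expression leaves the rejected walk as the only match, so the answer is
    empty and contains no subwalk of it.\<close>
  have "Matches D (word_rexp (replicate n a)) = {power n}"
  proof -
    have "es = replicate n e" if "es \<in> lists {e}" "map (\<lambda>_. a) es = replicate n a" for es
      using that by (metis in_lists_conv_set length_map length_replicate replicate_eqI singletonD)
    then show ?thesis
      by (auto simp: D_def Matches_bouquet power_def)
  qed
  then show False
    using guarantee D f[OF D] n unfolding subwalk_guarantee_def by fastforce
qed

theorem lemma55:
  "(subwalk_guarantee (SM :: ('v :: {countable, infinite}, 'e :: {countable, infinite},
        'l :: {countable, infinite}) semantics) \<and>
    subwalk_guarantee (BT :: ('v, 'e, 'l) semantics)) \<and>
   (\<not> subwalk_guarantee (ShVC :: ('v, 'e, 'l) semantics) \<and>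
    \<not> subwalk_guarantee (ShMS :: ('v, 'e, 'l) semantics) \<and>
    \<not> subwalk_guarantee (MM :: ('v, 'e, 'l) semantics) \<and>
    \<not> subwalk_guarantee (Sh :: ('v, 'e, 'l) semantics)) \<and>
   (\<forall>S :: ('v, 'e, 'l) semantics.
      is_semantics S \<and> filter_based S \<longrightarrow> \<not> subwalk_guarantee S)"
  by (simp add: subwalk_guarantee_SM subwalk_guarantee_BT not_subwalk_guarantee_ShVC
      not_subwalk_guarantee_ShMS not_subwalk_guarantee_MM not_subwalk_guarantee_Sh
      not_subwalk_guarantee_filter_based)

end
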